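(* Let $K$ be a locally compact field with a nontrivial non-Archimedean absolute value, with ring of integers $\mathcal{O}$ and normalized Haar measure $\mu$. Let $f:\mathcal{O}\to\mathbb{R}$ be a continuous function and let $X$ be a finite nonempty subset of $\mathcal{O}$ with discrepancy $\Delta(X)$. Then \[\left|\frac{1}{|X|}\sum_{x\in X}f(x)-\int_{\mathcal{O}}f\,d\mu\right|\le V_{\mathrm{Fourier}}(f)\,\Delta(X).\]
   Context: $\mathcal{O}=\{x\in K:|x|\le1\}$, $\pi$ a uniformizer, $q$ the order of $\mathcal{O}/\pi\mathcal{O}$, $|\pi|=1/q$; $\mu$ is Haar measure on $\mathcal{O}$ with $\mu(\mathcal{O})=1$. A disc is $D_r(a)=\{x\in K:|x-a|\le r\}$, $r\in q^{\mathbb{Z}}$, $r>0$; $\Delta(X)=\sup_{D\subseteq\mathcal{O}}\left|\frac{|X\cap D|}{|X|}-\mu(D)\right|$ over discs $D\subseteq\mathcal{O}$. $\widehat{\mathcal{O}}$ is the group of continuous additive characters $\gamma:\mathcal{O}\to\{z\in\mathbb{C}:|z|=1\}$, $\gamma_0$ the trivial character; the level $\ell(\gamma)$ is the smallest nonnegative integer $\ell$ with $\gamma\equiv1$ on $\pi^\ell\mathcal{O}$. $\hat f(\gamma)=\int_{\mathcal{O}}f(x)\overline{\gamma(x)}\,d\mu(x)$. Fourier-analytic variation: $V_{\mathrm{Fourier}}(f)=\sum_{\gamma\in\widehat{\mathcal{O}},\gamma\neq\gamma_0}q^{\ell(\gamma)}|\hat f(\gamma)|$ (possibly $+\infty$).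 *)

theory Defs
  imports "HOL-Analysis.Analysis"
begin

definition nonarch_abs_value :: "('k::field \<Rightarrow> real) \<Rightarrow> bool" where
  "nonarch_abs_value v \<longleftrightarrow>
     (\<forall>x. 0 \<le> v x) \<and> (\<forall>x. v x = 0 \<longleftrightarrow> x = 0) \<and>
     (\<forall>x y. v (x * y) = v x * v y) \<and>
     (\<forall>x y. v (x + y) \<le> max (v x) (v y))"

definition nontrivial_abs_value :: "('k::field \<Rightarrow> real) \<Rightarrow> bool" where
  "nontrivial_abs_value v \<longleftrightarrow> (\<exists>x. x \<noteq> 0 \<and> v x \<noteq> 1)"

definition int_ring :: "('k::field \<Rightarrow> real) \<Rightarrow> 'k set" where
  "int_ring v = {x. v x \<le> 1}"

definition multiples :: "('k::field \<Rightarrow> real) \<Rightarrow> 'k \<Rightarrow> 'k set" where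
  "multiples v a = (\<lambda>x. a * x) ` int_ring v"

text \<open>A uniformizer is a generator of the maximal ideal of the ring of integers.\<close>

definition uniformizer :: "('k::field \<Rightarrow> real) \<Rightarrow> 'k \<Rightarrow> bool" where
  "uniformizer v \<pi> \<longleftrightarrow> multiples v \<pi> = {x. v x < 1}"

definition residue_order :: "('k::field \<Rightarrow> real) \<Rightarrow> 'k \<Rightarrow> nat" where
  "residue_order v \<pi> =
     card (int_ring v // {(x, y). x \<in> int_ring v \<and> y \<in> int_ring v \<and> x - y \<in> multiples v \<pi>})"

text \<open>Normalized Haar measure on the compact additive group of the ring of integers, as a measure
  on its Borel sets. Regularity is not listed: a finite Borel measure on a compact metric space is
  automatically regular.\<close>

definition normalized_haar ::
  "('k::{field,metric_space} \<Rightarrow> real) \<Rightarrow> 'k measure \<Rightarrow> bool" where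
  "normalized_haar v \<mu> \<longleftrightarrow>
     sets \<mu> = sets (restrict_space borel (int_ring v)) \<and>
     emeasure \<mu> (int_ring v) = 1 \<and>
     (\<forall>a\<in>int_ring v. \<forall>A\<in>sets \<mu>. emeasure \<mu> ((\<lambda>x. a + x) ` A) = emeasure \<mu> A)"

definition disc :: "('k::field \<Rightarrow> real) \<Rightarrow> 'k \<Rightarrow> real \<Rightarrow> 'k set" where
  "disc v a r = {x. v (x - a) \<le> r}"

definition discs :: "('k::field \<Rightarrow> real) \<Rightarrow> 'k \<Rightarrow> 'k set set" where
  "discs v \<pi> = {disc v a (real (residue_order v \<pi>) powi k) | a k. True}"

text \<open>The supremum below is over a nonempty set of reals contained in the interval from 0 to 1,
  so it is a genuine least upper bound.\<close>

definition discrepancy ::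
  "('k::field \<Rightarrow> real) \<Rightarrow> 'k \<Rightarrow> 'k measure \<Rightarrow> 'k set \<Rightarrow> real" where
  "discrepancy v \<pi> \<mu> X =
     (SUP D\<in>{D \<in> discs v \<pi>. D \<subseteq> int_ring v}.
        \<bar>real (card (X \<inter> D)) / real (card X) - measure \<mu> D\<bar>)"

text \<open>Characters live on the ring of integers only. Functions being total, they are taken
  extensional (equal to \<open>undefined\<close> elsewhere), so that each character is counted exactly once.\<close>

definition characters :: "('k::{field,metric_space} \<Rightarrow> real) \<Rightarrow> ('k \<Rightarrow> complex) set" where
  "characters v =
     {\<gamma> \<in> int_ring v \<rightarrow>\<^sub>E {z. norm z = 1}.
        continuous_on (int_ring v) \<gamma> \<and>
        (\<forall>x\<in>int_ring v. \<forall>y\<in>int_ring v. \<gamma> (x + y) = \<gamma> x * \<gamma> y)}"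

definition trivial_char :: "('k::field \<Rightarrow> real) \<Rightarrow> 'k \<Rightarrow> complex" where
  "trivial_char v = (\<lambda>x\<in>int_ring v. 1)"

definition level :: "('k::field \<Rightarrow> real) \<Rightarrow> 'k \<Rightarrow> ('k \<Rightarrow> complex) \<Rightarrow> nat" where
  "level v \<pi> \<gamma> = (LEAST l. \<forall>x\<in>multiples v (\<pi> ^ l). \<gamma> x = 1)"

definition fourier_coeff :: "'k measure \<Rightarrow> ('k \<Rightarrow> real) \<Rightarrow> ('k \<Rightarrow> complex) \<Rightarrow> complex" where
  "fourier_coeff \<mu> f \<gamma> = (\<integral>x. complex_of_real (f x) * cnj (\<gamma> x) \<partial>\<mu>)"

definition fourier_variation ::
  "('k::{field,metric_space} \<Rightarrow> real) \<Rightarrow> 'k \<Rightarrow> 'k measure \<Rightarrow> ('k \<Rightarrow> real) \<Rightarrow> ennreal" where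
  "fourier_variation v \<pi> \<mu> f =
     (\<Sum>\<^sub>\<infinity>\<gamma>\<in>characters v - {trivial_char v}.
        ennreal (real (residue_order v \<pi>) ^ level v \<pi> \<gamma> * norm (fourier_coeff \<mu> f \<gamma>)))"

end

theory Submission imports Defs begin

text \<open>Write \<open>q\<close> for the residue order, \<open>I n\<close> for the ideal generated by the \<open>n\<close>-th power of the
  uniformizer, and \<open>chars_mod n\<close> for the finite group of characters that are trivial on \<open>I n\<close>. Characters
  of subgroups extend, so \<open>chars_mod n\<close> separates the cosets of \<open>I n\<close>; hence the sum of \<open>\<gamma> x\<close> over
  \<open>\<gamma> \<in> chars_mod n\<close> is \<open>q ^ n\<close> on \<open>I n\<close> and \<open>0\<close> elsewhere. Thus the partial Fourier sum of \<open>f\<close> over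
  \<open>chars_mod n\<close> is the average of \<open>f\<close> over cosets of \<open>I n\<close>, which converges to \<open>f\<close> pointwise.
  A nontrivial character of level \<open>l\<close> is constant on the \<open>q ^ l\<close> cosets of \<open>I l\<close>, and its
  values there sum to zero, so its mean over \<open>X\<close> is at most \<open>q ^ l\<close> times the discrepancy.
  This bounds the error for each coset average of \<open>f\<close> by a finite partial sum of the variation
  times the discrepancy; then let \<open>n\<close> tend to infinity.\<close>

subsection \<open>Extending characters of subgroups\<close>

definition add_subgroup :: "'a::ring_1 set \<Rightarrow> bool" where
  "add_subgroup H \<longleftrightarrow> 0 \<in> H \<and> (\<forall>x\<in>H. \<forall>y\<in>H. x - y \<in> H)"

text \<open>Purely algebraic characters: continuity is left out and the values off \<open>H\<close>
  are arbitrary, which keeps extension arguments simple. \<open>chars_modI\<close> later turns such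
  a map into an element of \<open>characters\<close>.\<close>

definition unitary_hom :: "'a::ring_1 set \<Rightarrow> ('a \<Rightarrow> complex) \<Rightarrow> bool" where
  "unitary_hom H \<psi> \<longleftrightarrow> (\<forall>x\<in>H. norm (\<psi> x) = 1) \<and> (\<forall>x\<in>H. \<forall>y\<in>H. \<psi> (x + y) = \<psi> x * \<psi> y)"

lemma add_subgroupD:
  assumes "add_subgroup H"
  shows "0 \<in> H" and "x \<in> H \<Longrightarrow> y \<in> H \<Longrightarrow> x - y \<in> H" and "x \<in> H \<Longrightarrow> - x \<in> H"
    and "x \<in> H \<Longrightarrow> y \<in> H \<Longrightarrow> x + y \<in> H"
proof -
  show 0: "0 \<in> H" and d: "x \<in> H \<Longrightarrow> y \<in> H \<Longrightarrow> x - y \<in> H" for x y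
    using assms by (auto simp: add_subgroup_def)
  show m: "x \<in> H \<Longrightarrow> - x \<in> H" for x using d[OF 0, of x] by simp
  show "x \<in> H \<Longrightarrow> y \<in> H \<Longrightarrow> x + y \<in> H" using d[of x "- y"] m[of y] by simp
qed

lemma add_subgroup_of_int_mult:
  assumes "add_subgroup H" "x \<in> H"
  shows "of_int k * x \<in> H"
proof (induction k rule: int_induct[where k = 0])
  case base
  then show ?case using add_subgroupD(1)[OF assms(1)] by simp
next
  case (step1 i)
  then show ?case using add_subgroupD(4)[OF assms(1) _ assms(2), of "of_int i * x"]
    by (simp add: algebra_simps)
next
  case (step2 i)
  then show ?case using add_subgroupD(2)[OF assms(1) _ assms(2), of "of_int i * x"]
    by (simp add: algebra_simps)
qed

lemma unitary_hom_0:
  assumes "add_subgroup H" "unitary_hom H \<psi>"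
  shows "\<psi> 0 = 1"
proof -
  have "0 \<in> H" by (rule add_subgroupD[OF assms(1)])
  then have "\<psi> (0 + 0) = \<psi> 0 * \<psi> 0" "norm (\<psi> 0) = 1"
    using assms(2) by (auto simp: unitary_hom_def)
  then show ?thesis by auto
qed

lemma unitary_hom_diff:
  assumes "add_subgroup H" "unitary_hom H \<psi>" "x \<in> H" "y \<in> H"
  shows "\<psi> (x - y) = \<psi> x * cnj (\<psi> y)"
proof -
  have "\<psi> (x - y + y) = \<psi> (x - y) * \<psi> y"
    using assms add_subgroupD(2)[OF assms(1,3,4)] unfolding unitary_hom_def by blast
  moreover have "\<psi> y * cnj (\<psi> y) = 1"
    using assms(2,4) by (simp add: unitary_hom_def complex_norm_square[symmetric])
  ultimately show ?thesis by (simp add: mult.assoc)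
qed

lemma unitary_hom_of_int_mult:
  assumes "add_subgroup H" "unitary_hom H \<psi>" "x \<in> H"
  shows "\<psi> (of_int k * x) = \<psi> x powi k"
proof -
  have nz: "\<psi> x \<noteq> 0" and inv: "cnj (\<psi> x) = inverse (\<psi> x)"
    using assms(2,3) by (auto simp: unitary_hom_def inverse_complex_def complex_eq_iff cmod_def)
  show ?thesis
  proof (induction k rule: int_induct[where k = 0])
    case base
    then show ?case using unitary_hom_0[OF assms(1,2)] by simp
  next
    case (step1 i)
    have "\<psi> (of_int i * x + x) = \<psi> (of_int i * x) * \<psi> x"
      using assms(2,3) add_subgroup_of_int_mult[OF assms(1,3)] by (simp add: unitary_hom_def)
    then show ?case using step1 nz power_int_add_1[of "\<psi> x" i] by (simp add: distrib_right)
  next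
    case (step2 i)
    have "\<psi> (of_int i * x - x) = \<psi> (of_int i * x) * cnj (\<psi> x)"
      by (rule unitary_hom_diff[OF assms(1,2) add_subgroup_of_int_mult[OF assms(1,3)] assms(3)])
    then show ?case using step2 nz
      by (simp add: algebra_simps power_int_diff inv field_simps)
  qed
qed

text \<open>Elements of the subgroup generated by \<open>H\<close> and \<open>a\<close> have the
  form \<open>h + k a\<close>, so the extension must be \<open>\<psi> h * z powi k\<close>. The
  hypothesis on \<open>m\<close> says that \<open>m\<close> is the order of \<open>a\<close> modulo
  \<open>H\<close> (0 standing for infinite order), and \<open>z ^ m = \<psi> (m a)\<close> is
  exactly the compatibility condition. \<open>G\<close> only records that the extension stays inside
  an ambient group.\<close>

lemma unitary_hom_extend_by_root:
  fixes a :: "'a::ring_1"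
  assumes H: "add_subgroup H" and \<psi>: "unitary_hom H \<psi>"
    and m: "\<And>k::int. of_int k * a \<in> H \<longleftrightarrow> int m dvd k"
    and z: "norm z = 1" "z ^ m = \<psi> (of_nat m * a)"
    and G: "add_subgroup G" "H \<subseteq> G" "a \<in> G"
  obtains H' \<psi>' where "add_subgroup H'" "unitary_hom H' \<psi>'" "H \<subseteq> H'" "a \<in> H'" "H' \<subseteq> G"
    "\<And>x. x \<in> H \<Longrightarrow> \<psi>' x = \<psi> x" "\<psi>' a = z"
proof -
  define H' where "H' = {h + of_int k * a | h k. h \<in> H}"
  \<comment> \<open>An arbitrary choice of the coefficient of \<open>a\<close>; \<open>ev\<close>
    shows that \<open>\<psi>'\<close> does not depend on it.\<close>
  define \<kappa> where "\<kappa> x = (SOME k. x - of_int k * a \<in> H)" for x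
  define \<psi>' where "\<psi>' x = \<psi> (x - of_int (\<kappa> x) * a) * z powi (\<kappa> x)" for x
  have z0: "z \<noteq> 0" using z by auto
  have ev: "\<psi>' (h + of_int k * a) = \<psi> h * z powi k" if h: "h \<in> H" for h k
  proof -
    define l where "l = \<kappa> (h + of_int k * a)"
    have "h + of_int k * a - of_int l * a \<in> H"
      unfolding l_def \<kappa>_def by (rule someI[of _ k]) (use h in simp)
    then have "h + of_int k * a - of_int l * a - h \<in> H"
      using add_subgroupD(2)[OF H _ h] by blast
    moreover have "h + of_int k * a - of_int l * a - h = of_int (k - l) * a"
      by (simp add: algebra_simps)
    ultimately have "of_int (k - l) * a \<in> H" by simp
    then have "int m dvd k - l" using m by blast
    then obtain j where j: "k - l = int m * j" by (rule dvdE)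
    have ma: "of_nat m * a \<in> H" using m[of "int m"] by simp
    \<comment> \<open>Two admissible coefficients differ by \<open>m * j\<close>, so the two
      \<open>H\<close>-parts differ by \<open>j\<close> times \<open>m a\<close>, and
      \<open>\<psi>\<close> of that is a power of \<open>z ^ m\<close>.\<close>
    have eq: "h + of_int k * a - of_int l * a = h + of_int j * (of_nat m * a)"
    proof -
      have "of_int (k - l) = (of_int j * of_nat m :: 'a)"
        unfolding j by (simp add: mult_of_nat_commute)
      then have "of_int k * a - of_int l * a = of_int j * of_nat m * a"
        by (metis left_diff_distrib of_int_diff)
      then show ?thesis by (simp add: algebra_simps)
    qed
    have "\<psi> (h + of_int k * a - of_int l * a) = \<psi> h * \<psi> (of_nat m * a) powi j"
      unfolding eq using \<psi> h add_subgroup_of_int_mult[OF H ma] unitary_hom_of_int_mult[OF H \<psi> ma]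
      by (simp add: unitary_hom_def)
    also have "\<dots> = \<psi> h * z powi (k - l)"
      unfolding z(2)[symmetric] j by (simp add: power_int_mult)
    finally show ?thesis
      unfolding \<psi>'_def l_def[symmetric] using z0 by (simp add: power_int_diff)
  qed
  have sub: "add_subgroup H'"
    unfolding add_subgroup_def
  proof (intro conjI ballI)
    show "0 \<in> H'" unfolding H'_def using add_subgroupD(1)[OF H]
      by (auto intro!: exI[of _ 0])
  next
    fix x y assume "x \<in> H'" "y \<in> H'"
    then obtain h k h' k' where "x = h + of_int k * a" "y = h' + of_int k' * a" "h \<in> H" "h' \<in> H"
      unfolding H'_def by blast
    moreover from this have "x - y = (h - h') + of_int (k - k') * a" by (simp add: algebra_simps)
    ultimately show "x - y \<in> H'" unfolding H'_def using add_subgroupD(2)[OF H] by blast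
  qed
  have "unitary_hom H' \<psi>'"
    unfolding unitary_hom_def
  proof (intro conjI ballI)
    fix x assume "x \<in> H'"
    then obtain h k where "x = h + of_int k * a" "h \<in> H" unfolding H'_def by blast
    then show "norm (\<psi>' x) = 1" using ev \<psi> z(1)
      by (simp add: unitary_hom_def norm_mult norm_power_int)
  next
    fix x y assume "x \<in> H'" "y \<in> H'"
    then obtain h k h' k' where h: "x = h + of_int k * a" "y = h' + of_int k' * a" "h \<in> H" "h' \<in> H"
      unfolding H'_def by blast
    then have "x + y = (h + h') + of_int (k + k') * a" by (simp add: algebra_simps)
    then have "\<psi>' (x + y) = \<psi> (h + h') * z powi (k + k')"
      using ev h add_subgroupD(4)[OF H] by metis
    then show "\<psi>' (x + y) = \<psi>' x * \<psi>' y"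
      using ev h \<psi> z0 by (simp add: unitary_hom_def power_int_add)
  qed
  moreover have "H \<subseteq> H'" unfolding H'_def by (force intro: exI[of _ "0::int"])
  moreover have "a \<in> H'" unfolding H'_def
    by (rule CollectI, rule exI[of _ 0], rule exI[of _ 1]) (use add_subgroupD(1)[OF H] in simp)
  moreover have "H' \<subseteq> G" unfolding H'_def
    using G add_subgroup_of_int_mult[OF G(1,3)] add_subgroupD(4)[OF G(1)] by blast
  moreover have "\<psi>' x = \<psi> x" if "x \<in> H" for x using ev[OF that, of 0] by simp
  moreover have "\<psi>' a = z"
    using ev[OF add_subgroupD(1)[OF H], of 1] unitary_hom_0[OF H \<psi>] by simp
  ultimately show ?thesis using that sub by blast
qed

text \<open>The integers \<open>k\<close> with \<open>k a\<close> in \<open>H\<close> form a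
  subgroup of the integers. It contains \<open>M > 0\<close>, so division with remainder shows that
  its least positive element generates it.\<close>

lemma add_subgroup_order_modulo:
  fixes a :: "'a::ring_1"
  assumes H: "add_subgroup H" and M: "M > 0" "of_nat M * a \<in> H"
  obtains m where "m > 0" "\<And>k::int. of_int k * a \<in> H \<longleftrightarrow> int m dvd k"
proof
  define m where "m = (LEAST m. m > 0 \<and> of_nat m * a \<in> H)"
  have m: "m > 0 \<and> of_nat m * a \<in> H" unfolding m_def by (rule LeastI) (use M in blast)
  then show "m > 0" by simp
  show "of_int k * a \<in> H \<longleftrightarrow> int m dvd k" for k :: int
  proof
    assume k: "of_int k * a \<in> H"
    have "of_int (k mod int m) = (of_int k - of_int (k div int m) * of_nat m :: 'a)"
      by (metis minus_div_mult_eq_mod of_int_diff of_int_mult of_int_of_nat_eq)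
    then have "of_int (k mod int m) * a = of_int k * a - of_int (k div int m) * (of_nat m * a)"
      by (simp add: left_diff_distrib mult.assoc)
    also have "\<dots> \<in> H"
      using add_subgroupD(2)[OF H k] add_subgroup_of_int_mult[OF H] m by blast
    finally have "of_nat (nat (k mod int m)) * a \<in> H" using m by simp
    moreover have "nat (k mod int m) < m" using m by (simp add: nat_less_iff)
    ultimately have "nat (k mod int m) = 0"
      using not_less_Least[of "nat (k mod int m)" "\<lambda>m. m > 0 \<and> of_nat m * a \<in> H"]
      unfolding m_def[symmetric] by auto
    moreover have "0 \<le> k mod int m" using m by simp
    ultimately show "int m dvd k" unfolding dvd_eq_mod_eq_0 by linarith
  next
    assume "int m dvd k"
    then obtain j where "k = j * int m" by (metis dvdE mult.commute)
    then show "of_int k * a \<in> H"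
      using add_subgroup_of_int_mult[OF H, of "of_nat m * a" j] m by (simp add: mult.assoc)
  qed
qed

lemma unimodular_root:
  assumes "m > 0" "norm w = 1"
  obtains z :: complex where "norm z = 1" "z ^ m = w"
proof
  show "norm (cis (Arg w / real m)) = 1" by simp
  show "cis (Arg w / real m) ^ m = w"
    using assms rcis_cmod_Arg[of w] by (simp add: Complex.DeMoivre rcis_def)
qed

text \<open>The elements of \<open>F\<close> are adjoined one at a time. Since \<open>M\<close>
  kills \<open>G\<close> modulo \<open>H\<close>, each has finite positive order modulo the current
  subgroup, and the required root exists on the unit circle.\<close>

lemma unitary_hom_extend_finite:
  fixes G :: "'a::ring_1 set"
  assumes "finite F" "F \<subseteq> G" "add_subgroup G" "add_subgroup H" "unitary_hom H \<psi>" "H \<subseteq> G"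
    and M: "M > 0" "\<And>a. a \<in> G \<Longrightarrow> of_nat M * a \<in> H"
  shows "\<exists>H' \<psi>'. add_subgroup H' \<and> unitary_hom H' \<psi>' \<and> H \<subseteq> H' \<and> F \<subseteq> H' \<and> H' \<subseteq> G \<and>
    (\<forall>x\<in>H. \<psi>' x = \<psi> x)"
  using assms(1,2)
proof (induction F rule: finite_induct)
  case empty
  then show ?case using assms by blast
next
  case (insert a F)
  then obtain H' \<psi>' where *: "add_subgroup H'" "unitary_hom H' \<psi>'" "H \<subseteq> H'" "F \<subseteq> H'" "H' \<subseteq> G"
    "\<forall>x\<in>H. \<psi>' x = \<psi> x" by auto
  have a: "a \<in> G" using insert by auto
  obtain m where m: "m > 0" "\<And>k::int. of_int k * a \<in> H' \<longleftrightarrow> int m dvd k"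
    using add_subgroup_order_modulo[OF *(1) M(1)] M(2)[OF a] *(3) by blast
  have "of_nat m * a \<in> H'" using m(2)[of "int m"] by simp
  then have "norm (\<psi>' (of_nat m * a)) = 1" using *(2) by (auto simp: unitary_hom_def)
  then obtain z where z: "norm z = 1" "z ^ m = \<psi>' (of_nat m * a)"
    using unimodular_root[OF m(1)] by blast
  obtain H'' \<psi>'' where "add_subgroup H''" "unitary_hom H'' \<psi>''" "H' \<subseteq> H''" "a \<in> H''" "H'' \<subseteq> G"
    "\<And>x. x \<in> H' \<Longrightarrow> \<psi>'' x = \<psi>' x"
    using unitary_hom_extend_by_root[OF *(1,2) m(2) z assms(3) *(5) a] by blast
  then show ?case using *
    by (intro exI[of _ H''] exI[of _ \<psi>'']) auto
qed

text \<open>The trivial character of \<open>H\<close> is first extended to \<open>a\<close> by a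
  primitive root of unity, then to all of \<open>G\<close> by adjoining the finite set
  \<open>F\<close> of coset representatives.\<close>

lemma unitary_hom_separates:
  fixes G :: "'a::ring_1 set"
  assumes G: "add_subgroup G" and H: "add_subgroup H" "H \<subseteq> G"
    and M: "M > 0" "\<And>a. a \<in> G \<Longrightarrow> of_nat M * a \<in> H"
    and F: "finite F" "F \<subseteq> G" "\<And>x. x \<in> G \<Longrightarrow> \<exists>t\<in>F. x - t \<in> H"
    and a: "a \<in> G" "a \<notin> H"
  obtains \<psi> where "unitary_hom G \<psi>" "\<And>x. x \<in> H \<Longrightarrow> \<psi> x = 1" "\<psi> a \<noteq> 1"
proof -
  have one: "unitary_hom H (\<lambda>_. 1)" by (simp add: unitary_hom_def)
  obtain m where m: "m > 0" "\<And>k::int. of_int k * a \<in> H \<longleftrightarrow> int m dvd k"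
    using add_subgroup_order_modulo[OF H(1) M(1)] M(2)[OF a(1)] by blast
  \<comment> \<open>Order 1 would put \<open>a\<close> itself into \<open>H\<close>; order above 1
    is what makes the root of unity \<open>z\<close> different from 1.\<close>
  have m1: "m > 1" using m(1) m(2)[of 1] a(2) by (cases "m = 1") auto
  define z where "z = cis (2 * pi / real m)"
  have z: "norm z = 1" "z ^ m = 1" using m(1) by (auto simp: z_def Complex.DeMoivre)
  have "z \<noteq> 1"
  proof
    assume "z = 1"
    then have "cos (2 * pi / real m) = 1" by (simp add: z_def complex_eq_iff)
    then obtain j :: int where "2 * pi / real m = of_int j * 2 * pi"
      by (auto simp: cos_one_2pi_int)
    then have "1 = of_int j * real m" using m(1) by (simp add: field_simps)
    then have "real_of_int (j * int m) = real_of_int 1" by simp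
    then have "j * int m = 1" by (simp only: of_int_eq_iff)
    then show False using m1 by (auto simp: zmult_eq_1_iff)
  qed
  obtain H1 \<psi>1 where 1: "add_subgroup H1" "unitary_hom H1 \<psi>1" "H \<subseteq> H1" "a \<in> H1" "H1 \<subseteq> G"
    "\<And>x. x \<in> H \<Longrightarrow> \<psi>1 x = 1" "\<psi>1 a = z"
    using unitary_hom_extend_by_root[OF H(1) one m(2) z G H(2) a(1)] by blast
  have "of_nat M * x \<in> H1" if "x \<in> G" for x using M(2)[OF that] 1(3) by blast
  then obtain H2 \<psi>2 where 2: "add_subgroup H2" "unitary_hom H2 \<psi>2" "H1 \<subseteq> H2" "F \<subseteq> H2" "H2 \<subseteq> G"
    "\<forall>x\<in>H1. \<psi>2 x = \<psi>1 x"
    using unitary_hom_extend_finite[OF F(1,2) G 1(1,2,5) M(1)] by blast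
  have "x \<in> H2" if x: "x \<in> G" for x
  proof -
    obtain t where t: "t \<in> F" "x - t \<in> H" using F(3)[OF x] by blast
    then have "(x - t) + t \<in> H2" using 1(3) 2(3,4) by (intro add_subgroupD(4)[OF 2(1)]) auto
    then show ?thesis by simp
  qed
  then have "H2 = G" using 2(5) by blast
  then show ?thesis using that[of \<psi>2] 1 2 \<open>z \<noteq> 1\<close> by (simp add: subset_iff)
qed

subsection \<open>The quotients of the ring of integers\<close>

text \<open>The type class already supplies a metric; \<open>dist_eq\<close> identifies it with the
  one induced by \<open>v\<close>, so that continuity and Borel sets refer to the valuation
  topology.\<close>

locale nonarch_local_field =
  fixes v :: "'k::{field,metric_space} \<Rightarrow> real" and \<pi> :: 'k
  assumes nonarch: "nonarch_abs_value v" and nontrivial: "nontrivial_abs_value v"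
    and dist_eq: "dist x y = v (x - y)"
    and loc_compact: "locally_compact_space (euclidean :: 'k topology)"
    and uniformizer: "uniformizer v \<pi>"
    and v_uniformizer: "v \<pi> = 1 / real (residue_order v \<pi>)"
begin

abbreviation "q \<equiv> residue_order v \<pi>"
abbreviation "R \<equiv> int_ring v"
abbreviation "I n \<equiv> multiples v (\<pi> ^ n)"

section \<open>The absolute value and the size of the residue ring\<close>

lemma v_nonneg [simp]: "0 \<le> v x"
  and v_eq_0 [simp]: "v x = 0 \<longleftrightarrow> x = 0"
  and v_mult: "v (x * y) = v x * v y"
  and v_add: "v (x + y) \<le> max (v x) (v y)"
  using nonarch by (auto simp: nonarch_abs_value_def)

lemma v_0 [simp]: "v 0 = 0"
  by simp

lemma v_1 [simp]: "v 1 = 1"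
  using v_mult[of 1 1] v_eq_0[of 1] by (auto simp del: v_eq_0)

lemma v_power: "v (x ^ n) = v x ^ n"
  by (induction n) (auto simp: v_mult)

lemma v_minus [simp]: "v (- x) = v x"
  using dist_commute[of x 0] by (simp add: dist_eq)

lemma v_diff: "v (x - y) \<le> max (v x) (v y)"
  using v_add[of x "- y"] by simp

lemma v_divide: "v (x / y) = v x / v y"
proof (cases "y = 0")
  case False
  then have "v x = v (x / y) * v y" by (simp flip: v_mult)
  then show ?thesis using False by simp
qed simp

lemma add_subgroup_int_ring: "add_subgroup R"
  using order_trans[OF v_diff] by (auto simp: add_subgroup_def int_ring_def)

lemma v_uniformizer_less_1: "v \<pi> < 1"
proof -
  have "\<pi> \<in> multiples v \<pi>" unfolding multiples_def int_ring_def
    by (rule image_eqI[of _ _ 1]) auto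
  then show ?thesis using uniformizer by (simp add: uniformizer_def)
qed

text \<open>Otherwise the maximal ideal would be zero, whereas nontriviality gives a nonzero
  \<open>x\<close> such that \<open>x\<close> or \<open>1 / x\<close> lies in it.\<close>

lemma uniformizer_nonzero: "\<pi> \<noteq> 0"
proof
  assume "\<pi> = 0"
  then have *: "{x. v x < 1} \<subseteq> {0}" using uniformizer by (auto simp: uniformizer_def multiples_def)
  obtain x where x: "x \<noteq> 0" "v x \<noteq> 1" using nontrivial by (auto simp: nontrivial_abs_value_def)
  then consider "v x < 1" | "v (1 / x) < 1" by (fastforce simp: v_divide)
  then show False using * x by cases auto
qed

text \<open>For an infinite residue ring \<open>card\<close> would return 0, and
  \<open>1 / 0 = 0\<close> would force \<open>v \<pi> = 0\<close>. Finiteness of the residue ring is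
  thus extracted from the normalization of \<open>v\<close>.\<close>

lemma residue_order_pos: "q > 0"
  using v_uniformizer uniformizer_nonzero v_eq_0[of \<pi>] by (auto simp del: v_eq_0)

lemma residue_order_gt_1: "real q > 1"
  using v_uniformizer_less_1 residue_order_pos by (simp add: v_uniformizer)

text \<open>Dividing by \<open>\<pi> ^ n\<close> is possible in the field, so the ideal is the
  closed ball of radius \<open>v (\<pi> ^ n)\<close> around 0. Most later facts about ideals are
  read off from this.\<close>

lemma ideal_eq: "I n = {x. v x \<le> (1 / real q) ^ n}"
proof -
  have pos: "v \<pi> ^ n > 0" using uniformizer_nonzero v_nonneg[of \<pi>] by (metis order_le_less v_eq_0 zero_less_power)
  have "x \<in> I n" if "v x \<le> v \<pi> ^ n" for x unfolding multiples_def
    by (rule image_eqI[of _ _ "x / \<pi> ^ n"])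
      (use that pos uniformizer_nonzero in \<open>auto simp: int_ring_def v_divide v_power\<close>)
  moreover have "v x \<le> v \<pi> ^ n" if "x \<in> I n" for x
    using that pos by (auto simp: multiples_def int_ring_def v_mult v_power mult_left_le)
  ultimately show ?thesis by (auto simp flip: v_uniformizer)
qed

lemma multiples_1 [simp]: "multiples v 1 = R"
  by (simp add: multiples_def)

lemma ideal_subset: "I n \<subseteq> R"
  using residue_order_gt_1 order_trans[OF _ power_le_one[of "1 / real q" n]]
  by (auto simp: ideal_eq int_ring_def)

lemma add_subgroup_ideal: "add_subgroup (I n)"
  using order_trans[OF v_diff] by (auto simp: add_subgroup_def ideal_eq)

lemma ideal_mult: "x \<in> I n \<Longrightarrow> y \<in> R \<Longrightarrow> x * y \<in> I n"
  by (auto simp: ideal_eq int_ring_def v_mult intro!: mult_left_le order_trans[OF mult_left_le])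

lemma int_ring_mult: "x \<in> R \<Longrightarrow> y \<in> R \<Longrightarrow> x * y \<in> R"
  using ideal_mult[of x 0 y] by simp

lemma uniformizer_mult_mem_ideal: "\<pi> * x \<in> I (Suc n) \<longleftrightarrow> x \<in> I n"
  using residue_order_pos unfolding ideal_eq by (simp add: v_mult v_uniformizer divide_le_cancel)

lemma of_nat_mem_int_ring: "of_nat n \<in> R"
  using add_subgroup_of_int_mult[OF add_subgroup_int_ring, of 1 "int n"]
  by (simp add: int_ring_def)

section \<open>Coset representatives modulo the ideals \<open>I n\<close>\<close>

definition transversal :: "nat \<Rightarrow> 'k set \<Rightarrow> bool" where
  "transversal n T \<longleftrightarrow> finite T \<and> T \<subseteq> R \<and> card T = q ^ n \<and>
     (\<forall>x\<in>R. \<exists>t\<in>T. x - t \<in> I n) \<and> (\<forall>s\<in>T. \<forall>t\<in>T. s - t \<in> I n \<longrightarrow> s = t)"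

lemma transversalD:
  assumes "transversal n T"
  shows "finite T" "T \<subseteq> R" "card T = q ^ n"
    "\<forall>x\<in>R. \<exists>t\<in>T. x - t \<in> I n" "\<forall>s\<in>T. \<forall>t\<in>T. s - t \<in> I n \<longrightarrow> s = t"
  using assms unfolding transversal_def by - (elim conjE, assumption)+

lemma transversal_unique:
  assumes "transversal n T" "s \<in> T" "t \<in> T" "s - t \<in> I n"
  shows "s = t"
  by (rule transversalD(5)[OF assms(1), rule_format, OF assms(2-4)])

lemma transversal_obtain:
  assumes "transversal n T" "x \<in> R"
  obtains t where "t \<in> T" "x - t \<in> I n"
  using bspec[OF transversalD(4)[OF assms(1)] assms(2)] by (elim bexE)

lemma transversalI:
  assumes "finite T" "T \<subseteq> R" "card T = q ^ n"
    and "\<And>x. x \<in> R \<Longrightarrow> \<exists>t\<in>T. x - t \<in> I n"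
    and "\<And>s t. s \<in> T \<Longrightarrow> t \<in> T \<Longrightarrow> s - t \<in> I n \<Longrightarrow> s = t"
  shows "transversal n T"
  unfolding transversal_def by (intro conjI ballI impI assms)

text \<open>One element is chosen from each class of the relation whose classes
  \<open>residue_order\<close> counts.\<close>

lemma transversal_1_exists: "\<exists>T. transversal 1 T"
proof -
  define E where "E = {(x, y). x \<in> R \<and> y \<in> R \<and> x - y \<in> multiples v \<pi>}"
  have I1: "multiples v \<pi> = I 1" by simp
  note I = add_subgroupD[OF add_subgroup_ideal[of 1]]
  have equiv: "equiv R E"
  proof (rule equivI)
    show "E \<subseteq> R \<times> R" by (auto simp: E_def)
    show "refl_on R E" using I(1) by (auto simp: E_def refl_on_def)
    show "sym E" unfolding E_def I1 using I(3) by (force intro!: symI)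
    show "trans E"
    proof (rule transI)
      fix x y z assume "(x, y) \<in> E" "(y, z) \<in> E"
      then show "(x, z) \<in> E" using I(4)[of "x - y" "y - z"] unfolding E_def I1 by auto
    qed
  qed
  define r where "r C = (SOME x. x \<in> C)" for C :: "'k set"
  have card: "card (R // E) = q" by (simp add: residue_order_def E_def)
  have r: "r C \<in> C" "r C \<in> R" if "C \<in> R // E" for C
  proof -
    show "r C \<in> C" unfolding r_def
      using in_quotient_imp_non_empty[OF equiv that] by (simp add: some_in_eq)
    then show "r C \<in> R" using in_quotient_imp_subset[OF equiv that] by auto
  qed
  have eq: "C = D" if "C \<in> R // E" "D \<in> R // E" "r C - r D \<in> I 1" for C D
  proof -
    have "(r C, r D) \<in> E" unfolding E_def I1 using r(2)[OF that(1)] r(2)[OF that(2)] that(3) by blast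
    then show ?thesis
      by (rule quotient_eqI[OF equiv that(1,2) r(1)[OF that(1)] r(1)[OF that(2)]])
  qed
  have inj: "inj_on r (R // E)"
    using eq I(1) by (intro inj_onI) auto
  have "transversal 1 (r ` (R // E))"
  proof (rule transversalI)
    show "card (r ` (R // E)) = q ^ 1" using inj card by (simp add: card_image)
    show "finite (r ` (R // E))"
      using card residue_order_pos by (intro finite_imageI card_ge_0_finite) simp
    show "r ` (R // E) \<subseteq> R" using r(2) by blast
    show "s = t" if "s \<in> r ` (R // E)" "t \<in> r ` (R // E)" "s - t \<in> I 1" for s t
      using eq that by blast
    fix x assume that: "x \<in> R"
    have C: "E `` {x} \<in> R // E" using that by (rule quotientI)
    then have "r (E `` {x}) \<in> E `` {x}" by (rule r)
    then have "(x, r (E `` {x})) \<in> E" by blast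
    then have "x - r (E `` {x}) \<in> I 1" by (simp only: E_def I1 mem_Collect_eq prod.case)
    then show "\<exists>t\<in>r ` (R // E). x - t \<in> I 1" using C by blast
  qed
  then show ?thesis ..
qed

text \<open>Expansion in powers of the uniformizer: if \<open>S\<close> represents the cosets of
  \<open>I 1\<close> and \<open>T\<close> those of \<open>I n\<close>, then the
  \<open>q * q ^ n\<close> elements \<open>s + \<pi> * t\<close> represent the cosets of
  \<open>I (Suc n)\<close>.\<close>

lemma transversal_exists: "\<exists>T. transversal n T"
proof (induction n)
  case 0
  then show ?case
    using add_subgroupD(1)[OF add_subgroup_int_ring]
    by (intro exI[of _ "{0}"] transversalI) auto
next
  case (Suc n)
  then obtain T where T: "transversal n T" by blast
  obtain S where S: "transversal 1 S" using transversal_1_exists by blast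
  define g where "g = (\<lambda>(s, t). s + \<pi> * t)"
  have pi: "\<pi> \<in> R" using v_uniformizer_less_1 by (simp add: int_ring_def)
  have I1: "\<pi> * x \<in> I 1" if "x \<in> R" for x
    using that uniformizer_mult_mem_ideal[of x 0] by simp
  have diffR: "x - y \<in> R" if "x \<in> R" "y \<in> R" for x y
    using add_subgroupD(2)[OF add_subgroup_int_ring that] .
  have sub: "x \<in> I 1" if "x \<in> I (Suc n)" for x
    using that residue_order_gt_1 power_decreasing[of 1 "Suc n" "1 / real q"]
    unfolding ideal_eq by auto
  \<comment> \<open>Modulo \<open>I 1\<close> only the leading digit survives, so
    \<open>s = s'\<close>; then \<open>\<pi>\<close> cancels and the rest is uniqueness modulo
    \<open>I n\<close>.\<close>
  have uniq: "s = s' \<and> t = t'"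
    if "s \<in> S" "s' \<in> S" "t \<in> T" "t' \<in> T" "g (s, t) - g (s', t') \<in> I (Suc n)" for s s' t t'
  proof -
    have R: "t \<in> R" "t' \<in> R" using transversalD(2)[OF T] that by auto
    have eq: "g (s, t) - g (s', t') = (s - s') + \<pi> * (t - t')" by (simp add: g_def algebra_simps)
    then have "(s - s') + \<pi> * (t - t') - \<pi> * (t - t') \<in> I 1"
      using that by (intro add_subgroupD(2)[OF add_subgroup_ideal] I1 diffR R sub) simp
    then have "s - s' \<in> I 1" by simp
    then have "s = s'" by (rule transversal_unique[OF S that(1,2)])
    moreover from this have "t - t' \<in> I n"
      using that(5) unfolding eq by (simp add: uniformizer_mult_mem_ideal del: power_Suc)
    ultimately show ?thesis using transversal_unique[OF T that(3,4)] by blast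
  qed
  have inj: "inj_on g (S \<times> T)"
  proof (rule inj_onI)
    fix a b assume ab: "a \<in> S \<times> T" "b \<in> S \<times> T" "g a = g b"
    then show "a = b"
      using uniq[of "fst a" "fst b" "snd a" "snd b"] add_subgroupD(1)[OF add_subgroup_ideal[of "Suc n"]]
      by (auto simp del: power_Suc)
  qed
  have ST: "finite S" "finite T" "S \<subseteq> R" "T \<subseteq> R" "card S = q" "card T = q ^ n"
    using transversalD(1-3)[OF S] transversalD(1-3)[OF T] by simp_all
  have "transversal (Suc n) (g ` (S \<times> T))"
  proof (rule transversalI)
    show "card (g ` (S \<times> T)) = q ^ Suc n"
      using ST inj by (simp add: card_image card_cartesian_product)
    show "finite (g ` (S \<times> T))" using ST by simp
    show "g ` (S \<times> T) \<subseteq> R"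
    proof
      fix u assume "u \<in> g ` (S \<times> T)"
      then obtain s t where st: "s \<in> R" "t \<in> R" "u = s + \<pi> * t"
        using ST by (auto simp: g_def)
      then show "u \<in> R"
        using add_subgroupD(4)[OF add_subgroup_int_ring st(1) int_ring_mult[OF pi st(2)]] by simp
    qed
    show "a = b" if "a \<in> g ` (S \<times> T)" "b \<in> g ` (S \<times> T)" "a - b \<in> I (Suc n)" for a b
      using that uniq by (auto simp del: power_Suc)
    fix x assume x: "x \<in> R"
    obtain s where s: "s \<in> S" "x - s \<in> I 1" using transversal_obtain[OF S x] .
    then obtain y where y: "x - s = \<pi> * y" "y \<in> R" by (auto simp: multiples_def)
    obtain t where t: "t \<in> T" "y - t \<in> I n" using transversal_obtain[OF T y(2)] .
    have "x - g (s, t) = \<pi> * (y - t)" using y by (simp add: g_def algebra_simps)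
    then have "x - g (s, t) \<in> I (Suc n)" using t by (simp add: uniformizer_mult_mem_ideal del: power_Suc)
    then show "\<exists>u\<in>g ` (S \<times> T). x - u \<in> I (Suc n)" using s t by blast
  qed
  then show ?case ..
qed

definition reps :: "nat \<Rightarrow> 'k set" where
  "reps n = (SOME T. transversal n T)"

definition rep :: "nat \<Rightarrow> 'k \<Rightarrow> 'k" where
  "rep n x = (SOME t. t \<in> reps n \<and> x - t \<in> I n)"

lemma transversal_reps: "transversal n (reps n)"
  unfolding reps_def using transversal_exists by (rule someI_ex)

lemma finite_reps [simp]: "finite (reps n)"
  and reps_subset: "reps n \<subseteq> R"
  and card_reps: "card (reps n) = q ^ n"
  by (rule transversalD[OF transversal_reps])+

lemma rep:
  assumes "x \<in> R"
  shows "rep n x \<in> reps n" and "x - rep n x \<in> I n"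
proof -
  have "\<exists>t. t \<in> reps n \<and> x - t \<in> I n" using transversal_obtain[OF transversal_reps assms] by blast
  from someI_ex[OF this] show "rep n x \<in> reps n" "x - rep n x \<in> I n" by (auto simp: rep_def)
qed

lemma rep_unique:
  assumes "t \<in> reps n" "x - t \<in> I n" "x \<in> R"
  shows "rep n x = t"
proof -
  have "(x - t) - (x - rep n x) \<in> I n"
    by (rule add_subgroupD(2)[OF add_subgroup_ideal assms(2) rep(2)[OF assms(3)]])
  then have "rep n x - t \<in> I n" by simp
  then show ?thesis
    by (rule transversal_unique[OF transversal_reps rep(1)[OF assms(3)] assms(1)])
qed

lemma rep_eq_iff: 
  assumes "x \<in> R" "y \<in> R"
  shows "rep n x = rep n y \<longleftrightarrow> x - y \<in> I n"
proof
  assume "rep n x = rep n y"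
  then have "(x - rep n x) - (y - rep n x) \<in> I n"
    using add_subgroupD(2)[OF add_subgroup_ideal rep(2)[OF assms(1)] rep(2)[OF assms(2)], of n] by simp
  then show "x - y \<in> I n" by simp
next
  assume "x - y \<in> I n"
  then have "(x - y) + (y - rep n y) \<in> I n"
    by (rule add_subgroupD(4)[OF add_subgroup_ideal _ rep(2)[OF assms(2)]])
  then show "rep n x = rep n y" using assms rep by (intro rep_unique) auto
qed

text \<open>Pigeonhole: two of the infinitely many natural numbers agree modulo \<open>I n\<close>,
  so their difference lies in this ideal, as do all its multiples. The argument is the same in every
  characteristic.\<close>

lemma quotient_torsion:  "\<exists>M>0. \<forall>x\<in>R. of_nat M * x \<in> I n"
proof -
  have "range (\<lambda>i. rep n (of_nat i)) \<subseteq> reps n" using rep(1) of_nat_mem_int_ring by blast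
  then have "\<not> inj (\<lambda>i::nat. rep n (of_nat i))"
    using finite_subset[OF _ finite_reps] finite_imageD[of "\<lambda>i::nat. rep n (of_nat i)" UNIV] by auto
  then obtain i j :: nat where "i \<noteq> j" "rep n (of_nat i) = rep n (of_nat j)" by (auto simp: inj_def)
  then obtain i j :: nat where ij: "i < j" "rep n (of_nat j) = rep n (of_nat i)"
    by (metis linorder_neqE_nat)
  then have "of_nat (j - i) \<in> I n" using of_nat_mem_int_ring by (simp add: rep_eq_iff of_nat_diff)
  then show ?thesis using ij ideal_mult by (intro exI[of _ "j - i"]) simp
qed

text \<open>A compact neighbourhood of 0 contains some closed ball \<open>I n\<close>, and division
  by \<open>\<pi> ^ n\<close> carries that ball continuously onto \<open>R\<close>.\<close>

lemma compact_int_ring: "compact R"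
proof -
  have "\<exists>U K. open U \<and> compact K \<and> (0::'k) \<in> U \<and> U \<subseteq> K"
    using bspec[OF loc_compact[unfolded locally_compact_space_def], of 0] by simp
  then obtain U K :: "'k set" where U: "open U" "compact K" "0 \<in> U" "U \<subseteq> K"
    by blast
  then obtain e where e: "e > 0" "ball 0 e \<subseteq> U" using openE by blast
  have "(\<lambda>n. (1 / real q) ^ n) \<longlonglongrightarrow> 0"
    using residue_order_gt_1 by (intro LIMSEQ_power_zero) simp
  then have "eventually (\<lambda>n. (1 / real q) ^ n < e) sequentially" using e(1) by (rule order_tendstoD)
  then obtain n where n: "(1 / real q) ^ n < e" by (auto simp: eventually_sequentially)
  have I: "I n = cball 0 ((1 / real q) ^ n)" by (auto simp: ideal_eq dist_eq)
  have "I n \<subseteq> K" using n e U unfolding I by (auto simp: subset_iff)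
  then have "compact (I n)" using compact_Int_closed[OF U(2), of "I n"] unfolding I
    by (simp add: Int_absorb1)
  moreover have "continuous_on (I n) (\<lambda>x. x / \<pi> ^ n)"
  proof (rule lipschitz_on_continuous_on)
    show "(1 / v (\<pi> ^ n))-lipschitz_on (I n) (\<lambda>x. x / \<pi> ^ n)"
      by (rule lipschitz_onI) (simp_all add: dist_eq v_divide flip: diff_divide_distrib)
  qed
  ultimately have "compact ((\<lambda>x. x / \<pi> ^ n) ` I n)" by (rule compact_continuous_image[rotated])
  moreover have "(\<lambda>x. x / \<pi> ^ n) ` I n = R"
    using uniformizer_nonzero by (auto simp: multiples_def image_image)
  ultimately show ?thesis by simp
qed

subsection \<open>Orthogonality of characters\<close>

lemma character_unitary_hom:
  assumes "\<gamma> \<in> characters v"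
  shows "unitary_hom R \<gamma>"
  using assms by (auto simp: characters_def unitary_hom_def PiE_def Pi_def)

lemma norm_character: "\<gamma> \<in> characters v \<Longrightarrow> x \<in> R \<Longrightarrow> norm (\<gamma> x) = 1"
  using character_unitary_hom by (auto simp: unitary_hom_def)

lemma character_add: "\<gamma> \<in> characters v \<Longrightarrow> x \<in> R \<Longrightarrow> y \<in> R \<Longrightarrow> \<gamma> (x + y) = \<gamma> x * \<gamma> y"
  using character_unitary_hom by (auto simp: unitary_hom_def)

lemma character_diff:
  "\<gamma> \<in> characters v \<Longrightarrow> x \<in> R \<Longrightarrow> y \<in> R \<Longrightarrow> \<gamma> (x - y) = \<gamma> x * cnj (\<gamma> y)"
  using unitary_hom_diff[OF add_subgroup_int_ring character_unitary_hom] .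

lemma characters_eqI:
  assumes "\<gamma> \<in> characters v" "\<gamma>' \<in> characters v" "\<And>x. x \<in> R \<Longrightarrow> \<gamma> x = \<gamma>' x"
  shows "\<gamma> = \<gamma>'"
  using assms by (auto simp: characters_def intro: PiE_ext)

section \<open>Characters of the finite quotients of \<open>R\<close> by \<open>I n\<close>\<close>

definition chars_mod :: "nat \<Rightarrow> ('k \<Rightarrow> complex) set" where
  "chars_mod n = {\<gamma> \<in> characters v. \<forall>x\<in>I n. \<gamma> x = 1}"

lemma chars_modD:
  assumes "\<gamma> \<in> chars_mod n"
  shows "\<gamma> \<in> characters v" and "x \<in> I n \<Longrightarrow> \<gamma> x = 1"
  using assms by (auto simp: chars_mod_def)

lemma chars_mod_cong:
  assumes "\<gamma> \<in> chars_mod n" "x \<in> R" "y \<in> R" "x - y \<in> I n"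
  shows "\<gamma> x = \<gamma> y"
proof -
  have "\<gamma> ((x - y) + y) = \<gamma> (x - y) * \<gamma> y"
    using assms chars_modD[OF assms(1)] ideal_subset by (intro character_add) auto
  then show ?thesis using chars_modD(2)[OF assms(1,4)] by simp
qed

text \<open>Being trivial on \<open>I n\<close> makes \<open>\<psi>\<close> constant on balls of
  radius \<open>(1 / q) ^ n\<close>, so continuity is automatic; \<open>restrict\<close> supplies
  the extensional form.\<close>

lemma chars_modI:
  assumes "unitary_hom R \<psi>" "\<And>x. x \<in> I n \<Longrightarrow> \<psi> x = 1"
  shows "restrict \<psi> R \<in> chars_mod n"
proof -
  have add: "\<psi> (x + y) = \<psi> x * \<psi> y" if "x \<in> R" "y \<in> R" for x y
    using assms(1) that by (simp add: unitary_hom_def)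
  have "continuous_on R (restrict \<psi> R)"
  proof (rule continuous_onI)
    fix x and e :: real assume x: "x \<in> R" and e: "e > 0"
    have "restrict \<psi> R y = restrict \<psi> R x" if y: "y \<in> R" "dist y x < (1 / real q) ^ n" for y
    proof -
      have "y - x \<in> I n" using y by (simp add: ideal_eq dist_eq)
      then have "\<psi> ((y - x) + x) = \<psi> x"
        using assms(2) ideal_subset[of n] x by (subst add) auto
      then show ?thesis using x y by simp
    qed
    then show "\<exists>d>0. \<forall>y\<in>R. dist y x < d \<longrightarrow> dist (restrict \<psi> R y) (restrict \<psi> R x) \<le> e"
      using residue_order_pos e by (intro exI[of _ "(1 / real q) ^ n"]) auto
  qed
  then show ?thesis
    using assms ideal_subset[of n] add_subgroupD(4)[OF add_subgroup_int_ring]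
    by (auto simp: chars_mod_def characters_def unitary_hom_def)
qed

lemma trivial_char_mem: "trivial_char v \<in> chars_mod n"
  unfolding trivial_char_def by (rule chars_modI) (auto simp: unitary_hom_def)

lemma trivial_char_apply: "x \<in> R \<Longrightarrow> trivial_char v x = 1"
  by (simp add: trivial_char_def)

text \<open>Such a character is determined by its values on \<open>reps n\<close>, and these are
  \<open>M\<close>-th roots of unity because \<open>M\<close> kills \<open>R\<close> modulo
  \<open>I n\<close>.\<close>

lemma finite_chars_mod [simp]: "finite (chars_mod n)"
proof -
  obtain M where M: "M > 0" "\<And>x. x \<in> R \<Longrightarrow> of_nat M * x \<in> I n"
    using quotient_torsion[of n] by blast
  have "(\<lambda>\<gamma>. restrict \<gamma> (reps n)) ` chars_mod n \<subseteq> reps n \<rightarrow>\<^sub>E {z. z ^ M = 1}"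
  proof (intro image_subsetI restrict_PiE_iff[THEN iffD2] ballI CollectI)
    fix \<gamma> t assume \<gamma>: "\<gamma> \<in> chars_mod n" and "t \<in> reps n"
    then have t: "t \<in> R" using reps_subset by blast
    have "\<gamma> (of_int (int M) * t) = \<gamma> t powi (int M)"
      by (rule unitary_hom_of_int_mult[OF add_subgroup_int_ring character_unitary_hom t])
        (rule chars_modD[OF \<gamma>])
    then show "\<gamma> t ^ M = 1" using chars_modD(2)[OF \<gamma> M(2)[OF t]] by simp
  qed
  moreover have "finite (reps n \<rightarrow>\<^sub>E {z::complex. z ^ M = 1})"
    using M(1) by (intro finite_PiE finite_reps finite_roots_unity) auto
  moreover have "inj_on (\<lambda>\<gamma>. restrict \<gamma> (reps n)) (chars_mod n)"
  proof (rule inj_onI)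
    fix \<gamma> \<gamma>' assume *: "\<gamma> \<in> chars_mod n" "\<gamma>' \<in> chars_mod n"
      "restrict \<gamma> (reps n) = restrict \<gamma>' (reps n)"
    show "\<gamma> = \<gamma>'"
    proof (rule characters_eqI)
      fix x assume x: "x \<in> R"
      have r: "rep n x \<in> R" using rep(1)[OF x] reps_subset by blast
      have "\<gamma> (rep n x) = \<gamma>' (rep n x)" using *(3) rep(1)[OF x] by (metis restrict_apply')
      then show "\<gamma> x = \<gamma>' x"
        using chars_mod_cong[OF *(1) x r rep(2)[OF x]] chars_mod_cong[OF *(2) x r rep(2)[OF x]]
        by simp
    qed (use * chars_modD in auto)
  qed
  ultimately show ?thesis by (meson finite_imageD finite_subset)
qed

text \<open>Translation by \<open>y\<close> permutes the cosets of \<open>I n\<close>, and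
  \<open>\<gamma>\<close> depends on the coset only; passing through \<open>rep\<close> turns this
  into a bijection of \<open>reps n\<close>.\<close>

lemma sum_reps_shift:
  assumes "\<gamma> \<in> chars_mod n" "y \<in> R"
  shows "(\<Sum>t\<in>reps n. \<gamma> (t + y)) = (\<Sum>t\<in>reps n. \<gamma> t)"
proof (rule sum.reindex_bij_witness[of _ "\<lambda>t. rep n (t - y)" "\<lambda>t. rep n (t + y)"])
  note add = add_subgroupD(4)[OF add_subgroup_int_ring] and diff = add_subgroupD(2)[OF add_subgroup_int_ring]
  fix t assume t: "t \<in> reps n"
  then have tR: "t \<in> R" using reps_subset by blast
  have plus: "t + y \<in> R" and minus: "t - y \<in> R" using add diff tR assms(2) by auto
  show "rep n (t + y) \<in> reps n" "rep n (t - y) \<in> reps n" using rep plus minus by auto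
  have r: "rep n (t + y) \<in> R" "rep n (t - y) \<in> R" using rep(1) plus minus reps_subset by blast+
  show "rep n (rep n (t + y) - y) = t"
    using add_subgroupD(3)[OF add_subgroup_ideal rep(2)[OF plus]] t diff r assms(2)
    by (intro rep_unique) (auto simp: algebra_simps)
  show "rep n (rep n (t - y) + y) = t"
    using add_subgroupD(3)[OF add_subgroup_ideal rep(2)[OF minus]] t add r assms(2)
    by (intro rep_unique) (auto simp: algebra_simps)
  show "\<gamma> (rep n (t + y)) = \<gamma> (t + y)"
    using chars_mod_cong[OF assms(1) plus r(1) rep(2)[OF plus]] by simp
qed

text \<open>Shifting by some \<open>y\<close> with \<open>\<gamma> y \<noteq> 1\<close> preserves
  the sum and also multiplies it by \<open>\<gamma> y\<close>.\<close>

lemma sum_reps_nontrivial: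
  assumes "\<gamma> \<in> chars_mod n" "\<gamma> \<noteq> trivial_char v"
  shows "(\<Sum>t\<in>reps n. \<gamma> t) = 0"
proof -
  note \<gamma> = chars_modD(1)[OF assms(1)]
  have "\<exists>y\<in>R. \<gamma> y \<noteq> 1"
  proof (rule ccontr)
    assume "\<not> ?thesis"
    then have "\<gamma> = trivial_char v"
      using \<gamma> chars_modD(1)[OF trivial_char_mem] by (intro characters_eqI) (auto simp: trivial_char_def)
    then show False using assms by simp
  qed
  then obtain y where y: "y \<in> R" "\<gamma> y \<noteq> 1" by blast
  have "(\<Sum>t\<in>reps n. \<gamma> t) = (\<Sum>t\<in>reps n. \<gamma> (t + y))" by (rule sum_reps_shift[symmetric]) fact+
  also have "\<dots> = (\<Sum>t\<in>reps n. \<gamma> t * \<gamma> y)"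
    using reps_subset y by (intro sum.cong refl character_add[OF \<gamma>]) auto
  finally show ?thesis using y(2) by (simp flip: sum_distrib_right)
qed

text \<open>The dual argument: multiplication by a character \<open>\<psi>\<close> trivial on
  \<open>I n\<close> with \<open>\<psi> x \<noteq> 1\<close> permutes the finite set
  \<open>chars_mod n\<close> and multiplies the sum by \<open>\<psi> x\<close>.\<close>

lemma sum_chars_mod_not_mem:
  assumes x: "x \<in> R" "x \<notin> I n"
  shows "(\<Sum>\<gamma>\<in>chars_mod n. \<gamma> x) = 0"
proof -
  obtain M where M: "M > 0" "\<And>x. x \<in> R \<Longrightarrow> of_nat M * x \<in> I n"
    using quotient_torsion[of n] by blast
  obtain \<psi> where \<psi>: "unitary_hom R \<psi>" "\<And>x. x \<in> I n \<Longrightarrow> \<psi> x = 1" "\<psi> x \<noteq> 1"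
  proof (rule unitary_hom_separates[OF add_subgroup_int_ring add_subgroup_ideal ideal_subset M])
    show "\<exists>t\<in>reps n. x - t \<in> I n" if "x \<in> R" for x using rep that by blast
  qed (use x reps_subset in auto)
  define \<theta> where "\<theta> \<gamma> = restrict (\<lambda>x. \<psi> x * \<gamma> x) R" for \<gamma>
  have "\<theta> ` chars_mod n \<subseteq> chars_mod n"
  proof (rule image_subsetI)
    fix \<gamma> assume \<gamma>: "\<gamma> \<in> chars_mod n"
    then have "unitary_hom R \<gamma>" using chars_modD(1) character_unitary_hom by blast
    then show "\<theta> \<gamma> \<in> chars_mod n"
      unfolding \<theta>_def using \<psi> chars_modD(2)[OF \<gamma>]
      by (intro chars_modI) (auto simp: unitary_hom_def norm_mult)
  qed
  moreover have inj: "inj_on \<theta> (chars_mod n)"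
  proof (rule inj_onI)
    fix \<gamma> \<gamma>' assume *: "\<gamma> \<in> chars_mod n" "\<gamma>' \<in> chars_mod n" "\<theta> \<gamma> = \<theta> \<gamma>'"
    show "\<gamma> = \<gamma>'"
    proof (rule characters_eqI)
      fix x assume x: "x \<in> R"
      then have "\<psi> x * \<gamma> x = \<psi> x * \<gamma>' x" using fun_cong[OF *(3), of x] by (simp add: \<theta>_def)
      moreover have "\<psi> x \<noteq> 0" using \<psi>(1) x by (auto simp: unitary_hom_def)
      ultimately show "\<gamma> x = \<gamma>' x" by simp
    qed (use * chars_modD in auto)
  qed
  ultimately have "\<theta> ` chars_mod n = chars_mod n" by (intro endo_inj_surj) auto
  then have "(\<Sum>\<gamma>\<in>chars_mod n. \<gamma> x) = (\<Sum>\<gamma>\<in>\<theta> ` chars_mod n. \<gamma> x)" by simp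
  also have "\<dots> = (\<Sum>\<gamma>\<in>chars_mod n. \<psi> x * \<gamma> x)"
    using x(1) by (subst sum.reindex[OF inj]) (simp add: \<theta>_def)
  finally show ?thesis using \<psi>(3) by (simp flip: sum_distrib_left)
qed

text \<open>On \<open>I n\<close> every term is 1, so the point is that \<open>chars_mod n\<close>
  has \<open>q ^ n\<close> elements. This follows by evaluating the double sum over
  \<open>reps n\<close> and \<open>chars_mod n\<close> in both orders, each time with a single
  surviving outer term.\<close>

lemma sum_chars_mod:
  assumes x: "x \<in> R"
  shows "(\<Sum>\<gamma>\<in>chars_mod n. \<gamma> x) = (if x \<in> I n then of_nat (q ^ n) else 0)"
proof (cases "x \<in> I n")
  case True
  have 0: "0 \<in> R" by (rule add_subgroupD(1)[OF add_subgroup_int_ring])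
  \<comment> \<open>Exactly one representative lies in \<open>I n\<close>; it is
    \<open>rep n 0\<close>, which may differ from 0 since the transversal is an arbitrary
    choice.\<close>
  have mem: "t \<in> I n \<longleftrightarrow> t = rep n 0" if "t \<in> reps n" for t
    using rep_unique[of t n 0] rep(2)[OF 0, of n] 0 that add_subgroupD(3)[OF add_subgroup_ideal[of n]]
    by (metis diff_0 minus_minus)
  have one: "(\<Sum>\<gamma>\<in>chars_mod n. \<gamma> y) = of_nat (card (chars_mod n))" if "y \<in> I n" for y
  proof -
    have "(\<Sum>\<gamma>\<in>chars_mod n. \<gamma> y) = (\<Sum>\<gamma>\<in>chars_mod n. 1)"
      using that by (intro sum.cong refl chars_modD(2))
    then show ?thesis by simp
  qed
  have "of_nat (card (chars_mod n)) = (\<Sum>\<gamma>\<in>chars_mod n. \<gamma> (rep n 0))"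
    using mem[OF rep(1)[OF 0]] one by simp
  also have "\<dots> = (\<Sum>t\<in>{rep n 0}. \<Sum>\<gamma>\<in>chars_mod n. \<gamma> t)" by simp
  also have "\<dots> = (\<Sum>t\<in>reps n. \<Sum>\<gamma>\<in>chars_mod n. \<gamma> t)"
    using rep(1)[OF 0] reps_subset mem
    by (intro sum.mono_neutral_left) (auto intro!: sum_chars_mod_not_mem)
  also have "\<dots> = (\<Sum>\<gamma>\<in>chars_mod n. \<Sum>t\<in>reps n. \<gamma> t)" by (rule sum.swap)
  also have "\<dots> = (\<Sum>\<gamma>\<in>{trivial_char v}. \<Sum>t\<in>reps n. \<gamma> t)"
    using trivial_char_mem sum_reps_nontrivial by (intro sum.mono_neutral_right) auto
  also have "\<dots> = (\<Sum>t\<in>reps n. trivial_char v t)" by simp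
  also have "\<dots> = (\<Sum>t\<in>reps n. 1)"
    using reps_subset by (intro sum.cong refl trivial_char_apply) auto
  also have "\<dots> = of_nat (q ^ n)" using card_reps by simp
  finally show ?thesis using True one by simp
qed (use sum_chars_mod_not_mem[OF x] in simp)

text \<open>Here \<open>n\<close> witnesses that the set under \<open>LEAST\<close> is nonempty, so
  the minimum defining the level is attained.\<close>

lemma chars_mod_level:
  assumes "\<gamma> \<in> chars_mod n"
  shows "\<gamma> \<in> chars_mod (level v \<pi> \<gamma>)"
proof -
  have "\<forall>x\<in>I (level v \<pi> \<gamma>). \<gamma> x = 1" unfolding level_def
    by (rule LeastI[of _ n]) (use chars_modD(2)[OF assms] in blast)
  then show ?thesis using assms by (simp add: chars_mod_def)
qed

end

subsection \<open>Haar measure and Fourier inversion\<close>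

locale nonarch_haar = nonarch_local_field +
  fixes \<mu> :: "'a measure"
  assumes haar: "normalized_haar v \<mu>"
begin

lemma sets_haar: "sets \<mu> = sets (restrict_space borel R)"
  using haar by (simp add: normalized_haar_def)

lemma space_haar [simp]: "space \<mu> = R"
  using sets_eq_imp_space_eq[OF sets_haar] by (simp add: space_restrict_space)

sublocale finite_measure \<mu>
  by (rule finite_measureI) (use haar in \<open>simp add: normalized_haar_def\<close>)

lemma measure_int_ring: "measure \<mu> R = 1"
  using haar by (simp add: normalized_haar_def measure_def)

text \<open>The same set serves three purposes: a coset for characters, a disc for the discrepancy
  and a closed ball for measurability and continuity.\<close>

definition coset :: "nat \<Rightarrow> 'a \<Rightarrow> 'a set" where
  "coset n t = {x. x - t \<in> I n}"

lemma coset_eq_disc: "coset n t = disc v t (real q powi - int n)"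
  by (auto simp: coset_def disc_def ideal_eq power_int_minus power_one_over inverse_eq_divide)

lemma coset_eq_cball: "coset n t = cball t ((1 / real q) ^ n)"
  unfolding coset_def ideal_eq cball_def by (subst dist_commute) (simp add: dist_eq)

lemma coset_subset:
  assumes "t \<in> R"
  shows "coset n t \<subseteq> R"
proof
  fix x assume "x \<in> coset n t"
  then have "(x - t) + t \<in> R"
    using ideal_subset assms by (intro add_subgroupD(4)[OF add_subgroup_int_ring]) (auto simp: coset_def)
  then show "x \<in> R" by simp
qed

lemma coset_sets [measurable]: "t \<in> R \<Longrightarrow> coset n t \<in> sets \<mu>"
  using coset_subset[of t n]
  by (auto simp: sets_haar sets_restrict_space coset_eq_cball intro!: image_eqI[of _ _ "coset n t"])

lemma reps_coset_iff: "t \<in> reps n \<Longrightarrow> x \<in> R \<Longrightarrow> x \<in> coset n t \<longleftrightarrow> rep n x = t"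
  using rep_unique rep by (auto simp: coset_def)

text \<open>Translation invariance gives the \<open>q ^ n\<close> cosets equal measure, and they
  partition \<open>R\<close>, which has measure 1.\<close>

lemma measure_coset:
  assumes "t \<in> R"
  shows "measure \<mu> (coset n t) = 1 / real q ^ n"
proof -
  have 0: "0 \<in> R" by (rule add_subgroupD(1)[OF add_subgroup_int_ring])
  have eq: "measure \<mu> (coset n s) = measure \<mu> (coset n 0)" if "s \<in> R" for s
  proof -
    have "coset n s = (\<lambda>x. s + x) ` coset n 0"
      by (auto simp: coset_def intro!: image_eqI[of _ _ "_ - s"])
    then show ?thesis using haar coset_sets[OF 0] that by (simp add: normalized_haar_def measure_def)
  qed
  have "disjoint_family_on (coset n) (reps n)"
    unfolding disjoint_family_on_def
  proof (intro ballI impI equals0I)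
    fix s t x assume "s \<in> reps n" "t \<in> reps n" "s \<noteq> t" "x \<in> coset n s \<inter> coset n t"
    then show False using reps_coset_iff[of s n x] reps_coset_iff[of t n x] coset_subset reps_subset
      by blast
  qed
  then have "measure \<mu> (\<Union>t\<in>reps n. coset n t) = (\<Sum>t\<in>reps n. measure \<mu> (coset n t))"
    using reps_subset[of n] by (intro finite_measure_finite_Union) (auto intro!: coset_sets)
  also have "\<dots> = (\<Sum>t\<in>reps n. measure \<mu> (coset n 0))"
    using reps_subset by (intro sum.cong refl eq) auto
  also have "\<dots> = real q ^ n * measure \<mu> (coset n 0)" by (simp add: card_reps)
  also have "(\<Union>t\<in>reps n. coset n t) = R"
  proof
    show "(\<Union>t\<in>reps n. coset n t) \<subseteq> R" using coset_subset reps_subset by blast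
    show "R \<subseteq> (\<Union>t\<in>reps n. coset n t)"
    proof
      fix x assume x: "x \<in> R"
      have "x \<in> coset n (rep n x)" using rep(2)[OF x] by (simp add: coset_def)
      then show "x \<in> (\<Union>t\<in>reps n. coset n t)" using rep(1)[OF x] by blast
    qed
  qed
  finally have "real q ^ n * measure \<mu> (coset n 0) = 1" using measure_int_ring by simp
  then show ?thesis using eq[OF assms] residue_order_pos by (simp add: field_simps)
qed

lemma integrable_continuous:
  fixes g :: "'a \<Rightarrow> 'b::{banach, second_countable_topology}"
  assumes "continuous_on R g"
  shows "integrable \<mu> g"
proof -
  have "g \<in> borel_measurable \<mu>"
    using borel_measurable_continuous_on_restrict[OF assms] measurable_cong_sets[OF sets_haar refl]
    by blast
  moreover obtain B where "\<And>x. x \<in> R \<Longrightarrow> norm (g x) \<le> B"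
    using compact_imp_bounded[OF compact_continuous_image[OF assms compact_int_ring]]
    unfolding bounded_iff by blast
  ultimately show ?thesis by (intro integrable_const_bound[of _ B]) auto
qed

lemma continuous_on_character: "\<gamma> \<in> characters v \<Longrightarrow> continuous_on R \<gamma>"
  by (simp add: characters_def)

lemma fourier_coeff_trivial:
  "fourier_coeff \<mu> f (trivial_char v) = complex_of_real (\<integral>x. f x \<partial>\<mu>)"
proof -
  have "fourier_coeff \<mu> f (trivial_char v) = (\<integral>x. complex_of_real (f x) \<partial>\<mu>)"
    unfolding fourier_coeff_def by (rule Bochner_Integration.integral_cong) (auto simp: trivial_char_def)
  then show ?thesis by simp
qed

text \<open>Exchanging sum and integral gives a convolution of \<open>f\<close> with the kernel
  \<open>\<Sum>\<gamma>. \<gamma> (x - y)\<close>, which by orthogonality is \<open>q ^ n\<close>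
  times the indicator of the coset of \<open>x\<close>.\<close>

lemma fourier_partial_sum:
  assumes f: "continuous_on R f" and x: "x \<in> R"
  shows "(\<Sum>\<gamma>\<in>chars_mod n. fourier_coeff \<mu> f \<gamma> * \<gamma> x) =
    complex_of_real (real q ^ n * (\<integral>y. indicator (coset n x) y * f y \<partial>\<mu>))"
proof -
  have int: "integrable \<mu> (\<lambda>y. complex_of_real (f y) * cnj (\<gamma> y))" if "\<gamma> \<in> chars_mod n" for \<gamma>
    using f continuous_on_character[OF chars_modD(1)[OF that]]
    by (intro integrable_continuous continuous_intros)
  have "(\<Sum>\<gamma>\<in>chars_mod n. fourier_coeff \<mu> f \<gamma> * \<gamma> x) =
    (\<Sum>\<gamma>\<in>chars_mod n. \<integral>y. complex_of_real (f y) * cnj (\<gamma> y) * \<gamma> x \<partial>\<mu>)"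
    unfolding fourier_coeff_def using int by (intro sum.cong refl) simp
  also have "\<dots> = (\<integral>y. (\<Sum>\<gamma>\<in>chars_mod n. complex_of_real (f y) * cnj (\<gamma> y) * \<gamma> x) \<partial>\<mu>)"
    using int by (intro Bochner_Integration.integral_sum[symmetric]) simp
  also have "\<dots> = (\<integral>y. complex_of_real (real q ^ n * (indicator (coset n x) y * f y)) \<partial>\<mu>)"
  proof (rule Bochner_Integration.integral_cong[OF refl])
    fix y assume "y \<in> space \<mu>"
    then have y: "y \<in> R" by simp
    have "(\<Sum>\<gamma>\<in>chars_mod n. complex_of_real (f y) * cnj (\<gamma> y) * \<gamma> x) =
      complex_of_real (f y) * (\<Sum>\<gamma>\<in>chars_mod n. \<gamma> (x - y))"
      unfolding sum_distrib_left
      by (intro sum.cong refl) (simp add: character_diff[OF chars_modD(1) x y])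
    also have "\<dots> = complex_of_real (f y) * (if x - y \<in> I n then of_nat (q ^ n) else 0)"
      using sum_chars_mod add_subgroupD(2)[OF add_subgroup_int_ring x y] by simp
    also have "x - y \<in> I n \<longleftrightarrow> y \<in> coset n x"
      using add_subgroupD(3)[OF add_subgroup_ideal[of n], of "x - y"]
        add_subgroupD(3)[OF add_subgroup_ideal[of n], of "y - x"] by (auto simp: coset_def)
    finally show "(\<Sum>\<gamma>\<in>chars_mod n. complex_of_real (f y) * cnj (\<gamma> y) * \<gamma> x) =
      complex_of_real (real q ^ n * (indicator (coset n x) y * f y))"
      by (simp add: indicator_def)
  qed
  also have "\<dots> = complex_of_real (real q ^ n * (\<integral>y. indicator (coset n x) y * f y \<partial>\<mu>))"
    by (simp del: of_real_mult of_real_power)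
  finally show ?thesis .
qed

text \<open>The cosets of \<open>x\<close> shrink to \<open>x\<close> and \<open>q ^ n\<close> is
  the inverse of their measure, so continuity of \<open>f\<close> at \<open>x\<close>
  suffices.\<close>

lemma coset_average_tendsto:
  fixes f :: "'a \<Rightarrow> real"
  assumes f: "continuous_on R f" and x: "x \<in> R"
  shows "(\<lambda>n. real q ^ n * (\<integral>y. indicator (coset n x) y * f y \<partial>\<mu>)) \<longlonglongrightarrow> f x"
proof (rule LIMSEQ_I)
  fix e :: real assume e: "e > 0"
  \<comment> \<open>Half of \<open>e\<close>, because integration only yields a weak inequality and
    the goal is strict.\<close>
  then obtain d where d: "d > 0" "\<And>y. y \<in> R \<Longrightarrow> dist y x < d \<Longrightarrow> dist (f y) (f x) < e / 2"
    using f x unfolding continuous_on_iff by (meson half_gt_zero)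
  have "(\<lambda>n. (1 / real q) ^ n) \<longlonglongrightarrow> 0"
    using residue_order_gt_1 by (intro LIMSEQ_power_zero) simp
  then have "eventually (\<lambda>n. (1 / real q) ^ n < d) sequentially" using d(1) by (rule order_tendstoD)
  then obtain N where N: "\<And>n. n \<ge> N \<Longrightarrow> (1 / real q) ^ n < d" by (auto simp: eventually_sequentially)
  have "norm (real q ^ n * (\<integral>y. indicator (coset n x) y * f y \<partial>\<mu>) - f x) < e" if n: "n \<ge> N" for n
  proof -
    have qn: "real q ^ n > 0" using residue_order_pos by simp
    have int: "integrable \<mu> (\<lambda>y. indicator (coset n x) y * f y)"
      using integrable_real_mult_indicator[OF coset_sets[OF x] integrable_continuous[OF f]]
      by (simp add: mult.commute)
    have int': "integrable \<mu> (\<lambda>y. indicator (coset n x) y * c)" for c :: real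
      using coset_sets[OF x] by (intro integrable_mult_left) (simp add: less_top[symmetric])
    have meas: "(\<integral>y. indicator (coset n x) y * c \<partial>\<mu>) = c / real q ^ n" for c :: real
      using coset_sets[OF x, of n] coset_subset[OF x, of n] measure_coset[OF x, of n]
      by (simp add: Int_absorb2)
    have "norm ((\<integral>y. indicator (coset n x) y * f y \<partial>\<mu>) - (\<integral>y. indicator (coset n x) y * f x \<partial>\<mu>)) =
      norm (\<integral>y. indicator (coset n x) y * f y - indicator (coset n x) y * f x \<partial>\<mu>)"
      using int int' by simp
    also have "\<dots> \<le> (\<integral>y. indicator (coset n x) y * (e / 2) \<partial>\<mu>)"
    proof (rule order_trans[OF Bochner_Integration.integral_norm_bound Bochner_Integration.integral_mono])
      fix y assume "y \<in> space \<mu>"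
      then have "y \<in> R" by simp
      then show "norm (indicator (coset n x) y * f y - indicator (coset n x) y * f x)
          \<le> indicator (coset n x) y * (e / 2)"
        using d(2)[of y] N[OF n]
        by (auto simp: indicator_def coset_eq_cball dist_commute[of x] simp flip: dist_real_def)
    qed (use int int' in auto)
    finally have "\<bar>(\<integral>y. indicator (coset n x) y * f y \<partial>\<mu>) - f x / real q ^ n\<bar> \<le> e / 2 / real q ^ n"
      unfolding meas by simp
    then have "real q ^ n * \<bar>(\<integral>y. indicator (coset n x) y * f y \<partial>\<mu>) - f x / real q ^ n\<bar>
        \<le> real q ^ n * (e / 2 / real q ^ n)"
      using qn by (intro mult_left_mono) simp_all
    also have "\<dots> < e" using qn e by simp
    also have "real q ^ n * \<bar>(\<integral>y. indicator (coset n x) y * f y \<partial>\<mu>) - f x / real q ^ n\<bar>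
        = \<bar>real q ^ n * ((\<integral>y. indicator (coset n x) y * f y \<partial>\<mu>) - f x / real q ^ n)\<bar>"
      by (simp add: abs_mult)
    also have "real q ^ n * ((\<integral>y. indicator (coset n x) y * f y \<partial>\<mu>) - f x / real q ^ n)
        = real q ^ n * (\<integral>y. indicator (coset n x) y * f y \<partial>\<mu>) - f x"
      unfolding right_diff_distrib using qn by simp
    finally show ?thesis by simp
  qed
  then show "\<exists>N. \<forall>n\<ge>N. norm (real q ^ n * (\<integral>y. indicator (coset n x) y * f y \<partial>\<mu>) - f x) < e"
    by blast
qed

section \<open>Character means over \<open>X\<close> and the discrepancy bound\<close>

lemma discrepancy_ge:
  assumes "D \<in> discs v \<pi>" "D \<subseteq> R" "finite X"
  shows "\<bar>real (card (X \<inter> D)) / real (card X) - measure \<mu> D\<bar> \<le> discrepancy v \<pi> \<mu> X"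
  unfolding discrepancy_def
proof (rule cSUP_upper)
  \<comment> \<open>A uniform bound by 1 gives the \<open>bdd_above\<close> condition that a
    supremum of reals requires.\<close>
  have "\<bar>real (card (X \<inter> D)) / real (card X) - measure \<mu> D\<bar> \<le> 1" for D
  proof -
    have "real (card (X \<inter> D)) / real (card X) \<le> 1"
      using card_mono[OF assms(3), of "X \<inter> D"] by (auto simp: divide_le_eq_1)
    moreover have "0 \<le> real (card (X \<inter> D)) / real (card X)" by simp
    moreover have "0 \<le> measure \<mu> D" "measure \<mu> D \<le> 1"
      using bounded_measure[of D] measure_int_ring by simp_all
    ultimately show ?thesis by linarith
  qed
  then show "bdd_above ((\<lambda>D. \<bar>real (card (X \<inter> D)) / real (card X) - measure \<mu> D\<bar>) `
      {D \<in> discs v \<pi>. D \<subseteq> R})"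
    by (intro bdd_aboveI2[of _ _ 1])
qed (use assms in auto)

text \<open>Grouping \<open>X\<close> by cosets writes the mean as a combination of
  \<open>q ^ n\<close> disc frequencies with unimodular coefficients. Since these coefficients sum
  to zero, each frequency can be replaced by its deviation from the measure of the disc.\<close>

lemma character_mean_le:
  assumes X: "finite X" "X \<noteq> {}" "X \<subseteq> R" and \<gamma>: "\<gamma> \<in> chars_mod n" "\<gamma> \<noteq> trivial_char v"
  shows "norm ((\<Sum>x\<in>X. \<gamma> x) / of_nat (card X)) \<le> real q ^ n * discrepancy v \<pi> \<mu> X"
proof -
  have card: "card X > 0" using X by (simp add: card_gt_0_iff)
  have "(\<Sum>x\<in>X. \<gamma> x) = (\<Sum>t\<in>reps n. \<Sum>x\<in>{x\<in>X. rep n x = t}. \<gamma> x)"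
    using X rep(1) by (intro sum.group[symmetric]) auto
  also have "\<dots> = (\<Sum>t\<in>reps n. \<gamma> t * of_nat (card (X \<inter> coset n t)))"
  proof (rule sum.cong[OF refl])
    fix t assume t: "t \<in> reps n"
    have eq: "{x\<in>X. rep n x = t} = X \<inter> coset n t" using X(3) reps_coset_iff[OF t] by blast
    have "(\<Sum>x\<in>X \<inter> coset n t. \<gamma> x) = (\<Sum>x\<in>X \<inter> coset n t. \<gamma> t)"
      using X(3) t reps_subset
      by (intro sum.cong refl chars_mod_cong[OF \<gamma>(1)]) (auto simp: coset_def)
    then show "(\<Sum>x\<in>{x\<in>X. rep n x = t}. \<gamma> x) = \<gamma> t * of_nat (card (X \<inter> coset n t))"
      unfolding eq by simp
  qed
  finally have "(\<Sum>x\<in>X. \<gamma> x) / of_nat (card X) =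
      (\<Sum>t\<in>reps n. \<gamma> t * (of_nat (card (X \<inter> coset n t)) / of_nat (card X)))"
    by (simp add: sum_divide_distrib)
  \<comment> \<open>The subtracted term is zero; \<open>1 / q ^ n\<close> is the common measure of
    the cosets.\<close>
  also have "\<dots> = (\<Sum>t\<in>reps n. \<gamma> t * (of_nat (card (X \<inter> coset n t)) / of_nat (card X)))
      - (\<Sum>t\<in>reps n. \<gamma> t) * complex_of_real (1 / real q ^ n)"
    using sum_reps_nontrivial[OF \<gamma>] by simp
  also have "\<dots> = (\<Sum>t\<in>reps n. \<gamma> t * complex_of_real
      (real (card (X \<inter> coset n t)) / real (card X) - measure \<mu> (coset n t)))"
    unfolding sum_distrib_right sum_subtractf[symmetric] using reps_subset[of n]
    by (intro sum.cong refl) (simp add: measure_coset subset_iff algebra_simps)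
  also have "norm \<dots> \<le> (\<Sum>t\<in>reps n. discrepancy v \<pi> \<mu> X)"
  proof (rule order_trans[OF norm_sum sum_mono])
    fix t assume t: "t \<in> reps n"
    then have tR: "t \<in> R" using reps_subset by blast
    have "coset n t \<in> discs v \<pi>" unfolding coset_eq_disc discs_def by blast
    then show "norm (\<gamma> t * complex_of_real
      (real (card (X \<inter> coset n t)) / real (card X) - measure \<mu> (coset n t))) \<le> discrepancy v \<pi> \<mu> X"
      using discrepancy_ge[OF _ coset_subset[OF tR] X(1), of n]
        norm_character[OF chars_modD(1)[OF \<gamma>(1)] tR]
      by (simp add: norm_mult del: of_real_diff of_real_divide)
  qed
  also have "\<dots> = real q ^ n * discrepancy v \<pi> \<mu> X" by (simp add: card_reps)
  finally show ?thesis .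
qed

text \<open>The trivial character contributes exactly the integral, so the error is a finite sum
  over nontrivial characters. The bound is independent of \<open>n\<close>, ready for the passage to
  the limit.\<close>

lemma koksma_coset_average:
  assumes f: "continuous_on R f" and X: "finite X" "X \<noteq> {}" "X \<subseteq> R"
  shows "ennreal \<bar>(\<Sum>x\<in>X. real q ^ n * (\<integral>y. indicator (coset n x) y * f y \<partial>\<mu>)) / real (card X)
      - (\<integral>x. f x \<partial>\<mu>)\<bar> \<le> fourier_variation v \<pi> \<mu> f * ennreal (discrepancy v \<pi> \<mu> X)"
proof -
  let ?\<Delta> = "discrepancy v \<pi> \<mu> X"
  let ?C = "chars_mod n - {trivial_char v}"
  let ?w = "\<lambda>\<gamma>. real q ^ level v \<pi> \<gamma> * norm (fourier_coeff \<mu> f \<gamma>)"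
  let ?A = "(\<Sum>x\<in>X. real q ^ n * (\<integral>y. indicator (coset n x) y * f y \<partial>\<mu>)) / real (card X)
      - (\<integral>x. f x \<partial>\<mu>)"
  have card: "card X > 0" using X by (simp add: card_gt_0_iff)
  \<comment> \<open>Nonnegativity is used to split the product under \<open>ennreal\<close>, which
    truncates negative reals to 0. The disc \<open>coset 0 0\<close> shows that the supremum has a
    nonnegative lower bound.\<close>
  have \<Delta>: "?\<Delta> \<ge> 0"
  proof -
    have 0: "0 \<in> R" by (rule add_subgroupD(1)[OF add_subgroup_int_ring])
    have "coset 0 0 \<in> discs v \<pi>" unfolding coset_eq_disc discs_def by blast
    then show ?thesis using order_trans[OF abs_ge_zero discrepancy_ge[OF _ coset_subset[OF 0] X(1)]]
      by blast
  qed
  have "complex_of_real (\<Sum>x\<in>X. real q ^ n * (\<integral>y. indicator (coset n x) y * f y \<partial>\<mu>)) =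
      (\<Sum>x\<in>X. \<Sum>\<gamma>\<in>chars_mod n. fourier_coeff \<mu> f \<gamma> * \<gamma> x)"
    unfolding of_real_sum using X(3) by (intro sum.cong refl fourier_partial_sum[OF f, symmetric]) auto
  also have "\<dots> = (\<Sum>\<gamma>\<in>chars_mod n. fourier_coeff \<mu> f \<gamma> * (\<Sum>x\<in>X. \<gamma> x))"
    unfolding sum_distrib_left by (rule sum.swap)
  also have "\<dots> = fourier_coeff \<mu> f (trivial_char v) * (\<Sum>x\<in>X. trivial_char v x) +
      (\<Sum>\<gamma>\<in>?C. fourier_coeff \<mu> f \<gamma> * (\<Sum>x\<in>X. \<gamma> x))"
    by (rule sum.remove[OF finite_chars_mod trivial_char_mem])
  also have "(\<Sum>x\<in>X. trivial_char v x) = of_nat (card X)"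
    using sum.cong[OF refl trivial_char_apply, of X "\<lambda>x. x"] X(3) by (simp add: subset_iff)
  finally have "complex_of_real ?A =
      (\<Sum>\<gamma>\<in>?C. fourier_coeff \<mu> f \<gamma> * (\<Sum>x\<in>X. \<gamma> x)) / of_nat (card X)"
    using card by (simp add: fourier_coeff_trivial field_simps)
  then have "\<bar>?A\<bar> = norm (\<Sum>\<gamma>\<in>?C. fourier_coeff \<mu> f \<gamma> * ((\<Sum>x\<in>X. \<gamma> x) / of_nat (card X)))"
    by (metis (mono_tags, lifting) norm_of_real sum.cong sum_divide_distrib times_divide_eq_right)
  also have "\<dots> \<le> (\<Sum>\<gamma>\<in>?C. ?w \<gamma> * ?\<Delta>)"
  proof (rule order_trans[OF norm_sum sum_mono])
    fix \<gamma> assume "\<gamma> \<in> ?C"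
    \<comment> \<open>The mean is estimated at the level of \<open>\<gamma>\<close> instead of at
      \<open>n\<close>; this produces the weight occurring in the variation.\<close>
    then have "norm ((\<Sum>x\<in>X. \<gamma> x) / of_nat (card X)) \<le> real q ^ level v \<pi> \<gamma> * ?\<Delta>"
      using chars_mod_level by (intro character_mean_le X) auto
    then have "norm (fourier_coeff \<mu> f \<gamma>) * norm ((\<Sum>x\<in>X. \<gamma> x) / of_nat (card X))
        \<le> norm (fourier_coeff \<mu> f \<gamma>) * (real q ^ level v \<pi> \<gamma> * ?\<Delta>)"
      by (rule mult_left_mono) simp
    then show "norm (fourier_coeff \<mu> f \<gamma> * ((\<Sum>x\<in>X. \<gamma> x) / of_nat (card X))) \<le> ?w \<gamma> * ?\<Delta>"
      unfolding norm_mult by (simp only: mult_ac)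
  qed
  finally have "ennreal \<bar>?A\<bar> \<le> ennreal ((\<Sum>\<gamma>\<in>?C. ?w \<gamma>) * ?\<Delta>)"
    by (simp add: ennreal_leI sum_distrib_right)
  also have "\<dots> = (\<Sum>\<gamma>\<in>?C. ennreal (?w \<gamma>)) * ennreal ?\<Delta>"
    using \<Delta> by (subst sum_ennreal) (simp_all add: ennreal_mult'')
  also have "\<dots> \<le> fourier_variation v \<pi> \<mu> f * ennreal ?\<Delta>"
  proof (rule mult_right_mono)
    \<comment> \<open>In \<open>ennreal\<close> the infinite sum is the supremum of its finite
      partial sums, so the comparison also covers infinite variation.\<close>
    show "(\<Sum>\<gamma>\<in>?C. ennreal (?w \<gamma>)) \<le> fourier_variation v \<pi> \<mu> f"
      unfolding fourier_variation_def nonneg_infsum_complete[OF zero_le]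
      by (rule SUP_upper) (auto dest: chars_modD(1))
  qed simp
  finally show ?thesis .
qed

end

theorem theorem6p3:
  fixes v :: "'k::{field,metric_space} \<Rightarrow> real" and \<pi> :: 'k and \<mu> :: "'k measure"
    and f :: "'k \<Rightarrow> real" and X :: "'k set"
  assumes "nonarch_abs_value v" and "nontrivial_abs_value v"
    and "\<And>x y. dist x y = v (x - y)"
    and "locally_compact_space (euclidean :: 'k topology)"
    and "uniformizer v \<pi>"
    and "v \<pi> = 1 / real (residue_order v \<pi>)"
    and "normalized_haar v \<mu>"
    and "continuous_on (int_ring v) f"
    and "finite X" and "X \<noteq> {}" and "X \<subseteq> int_ring v"
  shows "ennreal \<bar>(\<Sum>x\<in>X. f x) / real (card X) - (\<integral>x. f x \<partial>\<mu>)\<bar>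
           \<le> fourier_variation v \<pi> \<mu> f * ennreal (discrepancy v \<pi> \<mu> X)"
proof -
  interpret nonarch_haar v \<pi> \<mu>
    by unfold_locales (fact assms)+
  \<comment> \<open>As \<open>X\<close> is finite, pointwise convergence of the coset averages at
    its points is enough.\<close>
  have "(\<lambda>n. ennreal \<bar>(\<Sum>x\<in>X. real q ^ n * (\<integral>y. indicator (coset n x) y * f y \<partial>\<mu>)) / real (card X)
      - (\<integral>x. f x \<partial>\<mu>)\<bar>) \<longlonglongrightarrow> ennreal \<bar>(\<Sum>x\<in>X. f x) / real (card X) - (\<integral>x. f x \<partial>\<mu>)\<bar>"
    using assms(8,10,11) by (intro tendsto_intros coset_average_tendsto tendsto_ennrealI) 
      (auto simp: card_eq_0_iff assms(9))
  then show ?thesis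
    by (rule LIMSEQ_le_const2) (use koksma_coset_average[OF assms(8-11)] in blast)
qed

end
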